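(* Let $G$ be a distance-regular graph of diameter $d$ and valency $k$, with intersection numbers $a_i,b_i,c_i$ ($0\le i\le d$). Let $q$ be an integer with $1\le q\le d-1$ such that $a_{q-1}=0$, $c_{q+1}>c_q$ and $c_{q+1}\ge a_q$. Then, for any integer $p$ with $0\le p\le d$, we have $$d\le \max_{0\le r\le q-1}\left\{\left\lfloor\frac{b_p-c_p+b_r-c_r}{2c_q+M}\right\rfloor q+p+r\right\},$$ where the maximum is over integers $r$ and $$M=\left\lceil\frac{a_q(c_{q+1}-a_q)}{c_{q+1}-c_q}\right\rceil.$$
   Context: Graphs are simple and undirected; ${\rm d}(x,y)$ is the graph distance. For a vertex $x$, $S_h(x)$ is the set of vertices at distance exactly $h$ from $x$ (with $S_{-1}(x)=S_{d+1}(x)=\emptyset$, where $d$ is the diameter). A finite connected graph $G$ of diameter $d$ is called distance-regular if there are integers $b_i,c_i$, $0\le i\le d$, such that for any two vertices $x,y$ at distance $i$ one has $|S_{i+1}(x)\cap S_1(y)|=b_i$ and $|S_{i-1}(x)\cap S_1(y)|=c_i$. Such a graph is regular of valency $k=b_0$, with $b_d=c_0=0$ and $c_1=1$, and one sets $a_i=k-b_i-c_i=|S_i(x)\cap S_1(y)|$ for ${\rm d}(x,y)=i$. *)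

theory Defs
  imports "Graph_Theory.Graph_Theory"
begin

text \<open>
  Finite simple undirected graphs are the symmetric digraphs without loops and parallel arcs
  of the locale \<^locale>\<open>graph\<close>. The length of a walk is its number of arcs, so
  every undirected edge is traversed with length one in both directions.
\<close>

definition graph_dist :: "('a, 'b) pre_digraph \<Rightarrow> 'a \<Rightarrow> 'a \<Rightarrow> nat" where
  "graph_dist G x y = (LEAST n. \<exists>p. pre_digraph.awalk G x p y \<and> length p = n)"

definition graph_diameter :: "('a, 'b) pre_digraph \<Rightarrow> nat" where
  "graph_diameter G = Max {graph_dist G x y | x y. x \<in> verts G \<and> y \<in> verts G}"

text \<open>
  The radius is an integer, so that the conventions \<open>S\<^sub>-\<^sub>1(x) = {}\<close> and \<open>S\<^sub>d\<^sub>+\<^sub>1(x) = {}\<close>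
  hold automatically.
\<close>

definition dist_sphere :: "('a, 'b) pre_digraph \<Rightarrow> int \<Rightarrow> 'a \<Rightarrow> 'a set" where
  "dist_sphere G h x = {y \<in> verts G. int (graph_dist G x y) = h}"

text \<open>
  The index \<open>i = d(x, y)\<close> ranges over \<open>{0..d}\<close>; the values of \<open>b\<close> and \<open>c\<close> beyond the
  diameter are irrelevant.
\<close>

locale distance_regular_graph = graph G
  for G :: "('a, 'b) pre_digraph" +
  fixes b c :: "nat \<Rightarrow> int"
  assumes conn: "Digraph_Component.connected G"
    and b_count: "\<lbrakk>x \<in> verts G; y \<in> verts G; graph_dist G x y = i\<rbrakk> \<Longrightarrow>
      int (card (dist_sphere G (int i + 1) x \<inter> dist_sphere G 1 y)) = b i"
    and c_count: "\<lbrakk>x \<in> verts G; y \<in> verts G; graph_dist G x y = i\<rbrakk> \<Longrightarrow>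
      int (card (dist_sphere G (int i - 1) x \<inter> dist_sphere G 1 y)) = c i"

text \<open>
  The distance is the library's shortest-path cost for unit weights.
\<close>

lemma (in wf_digraph) graph_dist_eq_mu:
  assumes "x \<rightarrow>\<^sup>*\<^bsub>G\<^esub> y"
  shows "ereal (real (graph_dist G x y)) = \<mu> (\<lambda>_. 1) x y"
proof -
  let ?P = "\<lambda>n. \<exists>p. awalk x p y \<and> length p = n"
  have cost: "awalk_cost (\<lambda>_. 1) p = real (length p)" for p :: "'b list"
    by (induction p) auto
  from assms obtain p0 where "awalk x p0 y"
    by (auto simp: reachable_awalk)
  then have "?P (length p0)"
    by blast
  then have "?P (graph_dist G x y)"
    unfolding graph_dist_def by (rule LeastI)
  then obtain p where p: "awalk x p y" "length p = graph_dist G x y"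
    by blast
  have "graph_dist G x y \<le> length p'" if "awalk x p' y" for p'
    unfolding graph_dist_def using that by (blast intro: Least_le)
  then have "ereal (real (graph_dist G x y)) \<le> \<mu> (\<lambda>_. 1) x y"
    unfolding \<mu>_def cost by (intro INF_greatest) auto
  moreover have "\<mu> (\<lambda>_. 1) x y \<le> ereal (real (graph_dist G x y))"
    using min_cost_le_walk_cost[OF p(1), of "\<lambda>_. 1"] p(2) by (simp add: cost)
  ultimately show ?thesis
    by (rule antisym)
qed

end

theory Submission
  imports Defs
begin

text \<open>
  Let \<open>d(x, y) = q\<close> and \<open>d(z, y) = d(z, x) + q\<close> with \<open>i = d(z, x)\<close>. Moving from \<open>x\<close> to a neighbour
  changes the distance from \<open>z\<close> by \<open>b\<^sub>i - c\<^sub>i\<close> in total, and likewise at \<open>y\<close>. The \<open>c\<^sub>q\<close> neighbours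
  of \<open>x\<close> nearer to \<open>y\<close> are one step further from \<open>z\<close>, the \<open>c\<^sub>q\<close> neighbours of \<open>y\<close> nearer to \<open>x\<close> are
  one step nearer to \<open>z\<close>, and the remaining neighbours are compared by a weighted matching supported
  on pairs at distance \<open>q\<close> or \<open>q - 1\<close>. In such a pair the change at \<open>x\<close> is at least the change at
  \<open>y\<close>, with a surplus of one if the distance is \<open>q - 1\<close>. This yields
  \<open>(b\<^sub>i - c\<^sub>i) - (b\<^sub>i\<^sub>+\<^sub>q - c\<^sub>i\<^sub>+\<^sub>q) \<ge> 2c\<^sub>q + M\<close>. Iterating from \<open>p\<close> up to \<open>d - r\<close>, where
  \<open>r = (d - p) mod q\<close>, and using \<open>c\<^sub>d\<^sub>-\<^sub>r - b\<^sub>d\<^sub>-\<^sub>r \<le> b\<^sub>r - c\<^sub>r\<close> gives the bound.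
\<close>

section \<open>The distance of a connected graph\<close>

context distance_regular_graph
begin

abbreviation \<delta> :: "'a \<Rightarrow> 'a \<Rightarrow> nat" where
  "\<delta> \<equiv> graph_dist G"

abbreviation N :: "'a \<Rightarrow> 'a set" where
  "N \<equiv> dist_sphere G 1"

text \<open>The \<open>LEAST\<close> in \<open>graph_dist\<close> is attained only if some walk
  exists; connectedness and symmetric arcs supply one.\<close>

lemma ex_shortest_awalk:
  assumes "x \<in> verts G" "y \<in> verts G"
  obtains p where "awalk x p y" "length p = \<delta> x y"
proof -
  have "strongly_connected G"
    using conn sym_arcs by (rule symmetric_connected_imp_strongly_connected[rotated])
  then have "x \<rightarrow>\<^sup>*\<^bsub>G\<^esub> y"
    using assms by auto
  then obtain p where "awalk x p y"
    by (auto simp: reachable_awalk)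
  then have "\<exists>p. awalk x p y \<and> length p = length p"
    by blast
  then have "\<exists>n p. awalk x p y \<and> length p = n"
    by blast
  then have "\<exists>p. awalk x p y \<and> length p = \<delta> x y"
    unfolding graph_dist_def by (rule LeastI_ex)
  then show thesis
    using that by blast
qed

lemma dist_le_length: "awalk x p y \<Longrightarrow> \<delta> x y \<le> length p"
  unfolding graph_dist_def by (blast intro: Least_le)

lemma dist_self [simp]: "x \<in> verts G \<Longrightarrow> \<delta> x x = 0"
  using dist_le_length[of x "[]" x] by (simp add: awalk_Nil_iff)

lemma dist_triangle:
  assumes "x \<in> verts G" "y \<in> verts G" "z \<in> verts G"
  shows "\<delta> x z \<le> \<delta> x y + \<delta> y z"
proof -
  obtain p where p: "awalk x p y" "length p = \<delta> x y"
    using ex_shortest_awalk assms by metis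
  obtain r where r: "awalk y r z" "length r = \<delta> y z"
    using ex_shortest_awalk assms by metis
  show ?thesis
    using dist_le_length[OF awalk_appendI[OF p(1) r(1)]] p(2) r(2) by simp
qed

lemma ex_reverse_awalk:
  assumes "awalk x p y"
  shows "\<exists>p'. awalk y p' x \<and> length p' = length p"
  using assms
proof (induction p arbitrary: x)
  case Nil
  then show ?case by (auto simp: awalk_Nil_iff)
next
  case (Cons e es)
  then have e: "e \<in> arcs G" "x = tail G e" and es: "awalk (head G e) es y"
    by (auto simp: awalk_Cons_iff)
  obtain e' where e': "e' \<in> arcs G" "tail G e' = head G e" "head G e' = tail G e"
    using sym_arcs e(1) unfolding symmetric_conv by metis
  obtain p' where p': "awalk y p' (head G e)" "length p' = length es"
    using Cons.IH[OF es] by blast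
  have "awalk (head G e) [e'] x"
    using arc_implies_awalk[OF e'(1)] e' e(2) by simp
  then show ?case
    using awalk_appendI[OF p'(1)] p'(2) by (metis length_append_singleton length_Cons)
qed

lemma dist_sym:
  assumes "x \<in> verts G" "y \<in> verts G"
  shows "\<delta> x y = \<delta> y x"
proof -
  have "\<delta> v u \<le> \<delta> u v" if "u \<in> verts G" "v \<in> verts G" for u v
    using that by (metis ex_shortest_awalk ex_reverse_awalk dist_le_length)
  then show ?thesis
    using assms by (simp add: antisym)
qed

lemma ex_between:
  assumes "x \<in> verts G" "y \<in> verts G" "m \<le> \<delta> x y"
  obtains z where "z \<in> verts G" "\<delta> x z = m" "\<delta> z y = \<delta> x y - m"
proof -
  obtain p where p: "awalk x p y" "length p = \<delta> x y"
    using ex_shortest_awalk assms by metis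
  \<comment> \<open>Cut a shortest walk after m arcs. The two pieces bound the distances from above,
    and the triangle inequality forces equality.\<close>
  define z where "z = awlast x (take m p)"
  have "awalk x (take m p @ drop m p) y"
    using p(1) by simp
  then have walks: "awalk x (take m p) z" "awalk z (drop m p) y"
    unfolding z_def awalk_append_iff by auto
  then have z: "z \<in> verts G"
    by (auto simp: awalk_def)
  have "\<delta> x z \<le> m" "\<delta> z y \<le> \<delta> x y - m"
    using dist_le_length[OF walks(1)] dist_le_length[OF walks(2)] p(2) assms(3) by auto
  moreover have "\<delta> x y \<le> \<delta> x z + \<delta> z y"
    using dist_triangle assms z by metis
  ultimately show thesis
    using that[of z] z assms(3) by linarith
qed

lemma dist_eq_0D:
  assumes "x \<in> verts G" "y \<in> verts G" "\<delta> x y = 0"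
  shows "x = y"
  using assms by (metis ex_shortest_awalk length_0_conv awalk_Nil_iff)

lemma in_N_iff: "u \<in> N x \<longleftrightarrow> u \<in> verts G \<and> \<delta> x u = 1"
  by (auto simp: dist_sphere_def)

lemma finite_N [simp]: "finite (N x)"
  by (rule finite_subset[of _ "verts G"]) (auto simp: in_N_iff)

text \<open>Taking heads maps the arcs out of \<open>x\<close> bijectively to its neighbours:
  without loops no head is \<open>x\<close> itself, and without parallel arcs the map is
  injective.\<close>

lemma card_N:
  assumes "x \<in> verts G"
  shows "card (N x) = out_degree G x"
proof -
  have "head G ` out_arcs G x = N x"
  proof (intro equalityI subsetI)
    fix u
    assume "u \<in> head G ` out_arcs G x"
    then obtain e where e: "e \<in> arcs G" "tail G e = x" "head G e = u"
      by auto
    then have "\<delta> x u \<le> 1"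
      using dist_le_length[OF arc_implies_awalk[OF e(1)]] by simp
    moreover have u: "u \<in> verts G"
      using e by auto
    moreover have "\<delta> x u \<noteq> 0"
      using dist_eq_0D[OF assms u] e no_loops[of e] by auto
    ultimately show "u \<in> N x"
      by (simp add: in_N_iff)
  next
    fix u
    assume "u \<in> N x"
    then obtain p where "awalk x p u" "length p = 1"
      using ex_shortest_awalk assms unfolding in_N_iff by metis
    then obtain e where "awalk x [e] u"
      by (auto simp: length_Suc_conv)
    then show "u \<in> head G ` out_arcs G x"
      by (auto simp: awalk_Cons_iff awalk_Nil_iff)
  qed
  moreover have "inj_on (head G) (out_arcs G x)"
    using no_multi_arcs by (auto simp: inj_on_def arc_to_ends_def)
  ultimately show ?thesis
    unfolding out_degree_def by (metis card_image)
qed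

lemma dist_N:
  assumes "x \<in> verts G" "z \<in> verts G" "u \<in> N x"
  shows "\<delta> z u \<le> \<delta> z x + 1" "\<delta> z x \<le> \<delta> z u + 1"
  using assms dist_triangle[of z x u] dist_triangle[of z u x] dist_sym[of u x]
  by (auto simp: in_N_iff)

section \<open>Counting neighbours by distance\<close>

lemma card_N_farther:
  assumes "x \<in> verts G" "y \<in> verts G"
  shows "int (card {v \<in> N y. \<delta> x v = \<delta> x y + 1}) = b (\<delta> x y)"
proof -
  have "{v \<in> N y. \<delta> x v = \<delta> x y + 1} = dist_sphere G (int (\<delta> x y) + 1) x \<inter> N y"
    by (auto simp: dist_sphere_def)
  then show ?thesis
    using b_count[OF assms refl] by simp
qed

lemma card_N_closer:
  assumes "x \<in> verts G" "y \<in> verts G"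
  shows "int (card {v \<in> N y. \<delta> x v + 1 = \<delta> x y}) = c (\<delta> x y)"
proof -
  have "{v \<in> N y. \<delta> x v + 1 = \<delta> x y} = dist_sphere G (int (\<delta> x y) - 1) x \<inter> N y"
    by (auto simp: dist_sphere_def)
  then show ?thesis
    using c_count[OF assms refl] by simp
qed

lemma N_split:
  assumes "x \<in> verts G" "y \<in> verts G"
  shows "N y = {v \<in> N y. \<delta> x v + 1 = \<delta> x y} \<union> {v \<in> N y. \<delta> x v = \<delta> x y}
    \<union> {v \<in> N y. \<delta> x v = \<delta> x y + 1}"
  using dist_N[OF assms(2,1)] by force

lemma card_N_level:
  assumes "x \<in> verts G" "y \<in> verts G"
  shows "int (card {v \<in> N y. \<delta> x v = \<delta> x y}) = int (out_degree G y) - b (\<delta> x y) - c (\<delta> x y)"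
proof -
  have "card (N y) = card {v \<in> N y. \<delta> x v + 1 = \<delta> x y} + card {v \<in> N y. \<delta> x v = \<delta> x y}
    + card {v \<in> N y. \<delta> x v = \<delta> x y + 1}"
    by (subst N_split[OF assms], subst card_Un_disjoint, (auto)[3], subst card_Un_disjoint) auto
  then show ?thesis
    using card_N_farther[OF assms] card_N_closer[OF assms] card_N[OF assms(2)] by linarith
qed

lemma sum_dist_N:
  assumes "x \<in> verts G" "z \<in> verts G"
  shows "(\<Sum>u\<in>N x. int (\<delta> z u) - int (\<delta> z x)) = b (\<delta> z x) - c (\<delta> z x)"
proof -
  have "(\<Sum>u\<in>N x. int (\<delta> z u) - int (\<delta> z x))
    = (\<Sum>u\<in>N x. (if \<delta> z u = \<delta> z x + 1 then 1 else 0) - (if \<delta> z u + 1 = \<delta> z x then 1 else 0))"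
    using dist_N[OF assms] by (intro sum.cong) force+
  then show ?thesis
    using card_N_farther[OF assms(2,1)] card_N_closer[OF assms(2,1)]
    by (simp add: sum_subtractf sum.If_cases Int_def)
qed

text \<open>Since \<open>y\<close> lies on a geodesic from \<open>x\<close> to \<open>z\<close>, a
  neighbour of \<open>y\<close> nearer to one end is farther from the other. So each
  \<open>c\<close> at one end is at most the \<open>b\<close> at the other; add the two
  inequalities.\<close>

lemma c_diff_b_le:
  assumes "x \<in> verts G" "y \<in> verts G" "z \<in> verts G" "\<delta> x z = \<delta> x y + \<delta> y z"
  shows "c (\<delta> x y) - b (\<delta> x y) \<le> b (\<delta> y z) - c (\<delta> y z)"
proof -
  have dzy: "\<delta> z y = \<delta> y z"
    using assms dist_sym by blast
  have "{v \<in> N y. \<delta> x v + 1 = \<delta> x y} \<subseteq> {v \<in> N y. \<delta> z v = \<delta> z y + 1}"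
  proof
    fix v
    assume v: "v \<in> {v \<in> N y. \<delta> x v + 1 = \<delta> x y}"
    then have "v \<in> verts G"
      by (simp add: in_N_iff)
    then show "v \<in> {v \<in> N y. \<delta> z v = \<delta> z y + 1}"
      using v dist_triangle[of x v z] dist_sym[of v z] dist_N[of y z v] assms dzy by auto
  qed
  moreover have "{v \<in> N y. \<delta> z v + 1 = \<delta> z y} \<subseteq> {v \<in> N y. \<delta> x v = \<delta> x y + 1}"
  proof
    fix v
    assume v: "v \<in> {v \<in> N y. \<delta> z v + 1 = \<delta> z y}"
    then have "v \<in> verts G"
      by (simp add: in_N_iff)
    then show "v \<in> {v \<in> N y. \<delta> x v = \<delta> x y + 1}"
      using v dist_triangle[of x v z] dist_sym[of v z] dist_N[of y x v] assms dzy by auto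
  qed
  ultimately have "card {v \<in> N y. \<delta> x v + 1 = \<delta> x y} \<le> card {v \<in> N y. \<delta> z v = \<delta> z y + 1}"
    "card {v \<in> N y. \<delta> z v + 1 = \<delta> z y} \<le> card {v \<in> N y. \<delta> x v = \<delta> x y + 1}"
    by (auto intro!: card_mono)
  then show ?thesis
    using card_N_closer[of x y] card_N_closer[of z y] card_N_farther[of x y] card_N_farther[of z y]
      assms dzy by simp
qed

text \<open>The vertex before \<open>y\<close> on a geodesic from \<open>x\<close> is counted.
  Positivity allows division by \<open>c q\<close> later.\<close>

lemma c_pos:
  assumes "x \<in> verts G" "y \<in> verts G" "1 \<le> \<delta> x y"
  shows "0 < c (\<delta> x y)"
proof -
  obtain v where v: "v \<in> verts G" "\<delta> x v = \<delta> x y - 1" "\<delta> v y = \<delta> x y - (\<delta> x y - 1)"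
    using ex_between[OF assms(1,2), of "\<delta> x y - 1"] by auto
  then have "v \<in> {v \<in> N y. \<delta> x v + 1 = \<delta> x y}"
    using assms dist_sym[of v y] by (auto simp: in_N_iff)
  then have "card {v \<in> N y. \<delta> x v + 1 = \<delta> x y} > 0"
    by (auto simp: card_gt_0_iff)
  then show ?thesis
    using card_N_closer[OF assms(1,2)] by linarith
qed

end

section \<open>The weighted matching between two neighbourhoods\<close>

locale drg_step = distance_regular_graph +
  fixes k q :: nat and a :: int
  assumes regular: "x \<in> verts G \<Longrightarrow> out_degree G x = k"
    and q_pos: "1 \<le> q"
    and a_eq: "a = int k - b q - c q"
    and a_pred: "int k - b (q - 1) - c (q - 1) = 0"
    and c_less: "c q < c (q + 1)"
    and a_le: "a \<le> c (q + 1)"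
begin

text \<open>
  The two weights are forced by \<open>sum_w\<close>: a vertex \<open>u \<in> far_N x y\<close> at distance \<open>q + 1\<close> from \<open>y\<close> has
  \<open>c\<^sub>q\<^sub>+\<^sub>1 - c\<^sub>q\<close> partners in \<open>far_N y x\<close>, all at distance \<open>q\<close>; one at distance \<open>q\<close> from \<open>y\<close> has
  \<open>a\<^sub>q - c\<^sub>q\<close> partners at distance \<open>q\<close> and \<open>c\<^sub>q\<close> at distance \<open>q - 1\<close>.
\<close>

definition w :: "'a \<Rightarrow> 'a \<Rightarrow> real" where
  "w u v = (if \<delta> u v + 1 = q then real_of_int (c (q + 1) - a) / (c q * (c (q + 1) - c q))
    else if \<delta> u v = q then 1 / (c (q + 1) - c q) else 0)"

text \<open>For \<open>x\<close> and \<open>y\<close> at distance \<open>q\<close>, these are the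
  neighbours of \<open>x\<close> that remain once the \<open>c q\<close> nearer to \<open>y\<close>
  are removed; \<open>w\<close> matches them with \<open>far_N y x\<close>.\<close>

definition far_N :: "'a \<Rightarrow> 'a \<Rightarrow> 'a set" where
  "far_N x y = {u \<in> N x. q \<le> \<delta> u y}"

lemma finite_far_N [simp]: "finite (far_N x y)"
  by (simp add: far_N_def)

lemma far_N_eq:
  assumes "x \<in> verts G" "y \<in> verts G" "\<delta> y x = q"
  shows "far_N x y = N x - {u \<in> N x. \<delta> y u + 1 = q}"
proof -
  have "q \<le> \<delta> u y \<longleftrightarrow> \<delta> y u + 1 \<noteq> q" if "u \<in> N x" for u
    using dist_N(2)[OF assms(1,2) that] dist_sym[of u y] that assms by (auto simp: in_N_iff)
  then show ?thesis
    by (auto simp: far_N_def)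
qed

text \<open>Used with \<open>e\<close> equal to 1 at \<open>x\<close> and -1 at \<open>y\<close>;
  the difference produces the term \<open>2 * c q\<close>.\<close>

lemma sum_near_far:
  fixes h :: "'a \<Rightarrow> int"
  assumes xy: "x \<in> verts G" "y \<in> verts G" "\<delta> y x = q"
    and h: "\<And>u. \<lbrakk>u \<in> N x; \<delta> y u + 1 = q\<rbrakk> \<Longrightarrow> h u = e"
  shows "(\<Sum>u\<in>N x. h u) = c q * e + (\<Sum>u\<in>far_N x y. h u)"
proof -
  let ?C = "{u \<in> N x. \<delta> y u + 1 = q}"
  have "(\<Sum>u\<in>N x. h u) = (\<Sum>u\<in>far_N x y. h u) + (\<Sum>u\<in>?C. h u)"
    unfolding far_N_eq[OF xy] by (intro sum.subset_diff) auto
  also have "(\<Sum>u\<in>?C. h u) = (\<Sum>u\<in>?C. e)"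
    using h by (intro sum.cong) auto
  also have "\<dots> = c q * e"
    using card_N_closer[OF xy(2,1)] xy(3) by simp
  finally show ?thesis
    by simp
qed

text \<open>This is where \<open>a\<^sub>q\<^sub>-\<^sub>1 = 0\<close> enters.\<close>

lemma dist_far_near:
  assumes "x \<in> verts G" "y \<in> verts G" "\<delta> x y = q" "u \<in> far_N x y" "v \<in> N y" "\<delta> x v + 1 = q"
  shows "\<delta> u v = q"
proof -
  have u: "u \<in> verts G" "u \<in> N x" and v: "v \<in> verts G" and q: "q \<le> \<delta> u y"
    using assms by (auto simp: far_N_def in_N_iff)
  have vx: "\<delta> v x = q - 1"
    using assms(1,6) v dist_sym[of x v] by simp
  \<comment> \<open>This cardinality is the intersection number with index \<open>q - 1\<close>, so
    \<open>u\<close> cannot be at distance \<open>q - 1\<close> from \<open>v\<close>.\<close>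
  have "int (card {u \<in> N x. \<delta> v u = \<delta> v x}) = 0"
    using card_N_level[of v x] regular assms(1) v a_pred vx by simp
  then have "{u \<in> N x. \<delta> v u = \<delta> v x} = {}"
    by simp
  then have "\<delta> v u \<noteq> q - 1"
    using u(2) vx by auto
  moreover have "\<delta> v u \<le> q"
    using dist_N[of x v u] assms(1) u v vx q_pos by linarith
  moreover have "q \<le> \<delta> v u + 1"
    using dist_triangle[of u v y] u v assms(2,5) q dist_sym[of u v] dist_sym[of v y]
    by (auto simp: in_N_iff)
  ultimately show ?thesis
    using dist_sym[of u v] u v by simp
qed

lemma sum_w:
  assumes xy: "x \<in> verts G" "y \<in> verts G" "\<delta> x y = q" and ux: "u \<in> far_N x y"
  shows "(\<Sum>v\<in>far_N y x. w u v) = 1"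
    and "\<delta> u y = q \<Longrightarrow> int (card {v \<in> far_N y x. \<delta> u v + 1 = q}) = c q"
proof -
  have u: "u \<in> verts G" and uN: "u \<in> N x" and q: "q \<le> \<delta> u y"
    using ux by (auto simp: far_N_def in_N_iff)
  define D where "D = c (q + 1) - c q"
  have D: "D > 0"
    using c_less by (simp add: D_def)
  have cq: "c q > 0"
    using c_pos xy q_pos by metis
  define near where "near = {v \<in> N y. \<delta> x v + 1 = q}"
  have near: "int (card near) = c q"
    using card_N_closer[of x y] xy by (simp add: near_def)
  have far_eq: "far_N y x = N y - near"
    unfolding near_def by (rule far_N_eq[OF xy(2,1,3)])
  \<comment> \<open>Hence removing \<open>near\<close> from \<open>N y\<close> leaves the vertices
    at distance \<open>q - 1\<close> from \<open>u\<close> untouched and takes exactly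
    \<open>c q\<close> from those at distance \<open>q\<close>.\<close>
  have near_q: "\<delta> u v = q" if "v \<in> near" for v
    using dist_far_near[OF xy ux] that by (auto simp: near_def)
  define A where "A = {v \<in> far_N y x. \<delta> u v + 1 = q}"
  define B where "B = {v \<in> far_N y x. \<delta> u v = q}"
  have A_eq: "A = {v \<in> N y. \<delta> u v + 1 = q}"
  proof -
    have "v \<notin> near" if "\<delta> u v + 1 = q" for v
      using near_q[of v] that by linarith
    then show ?thesis
      unfolding A_def far_eq by blast
  qed
  have B_card: "int (card B) = int (card {v \<in> N y. \<delta> u v = q}) - c q"
  proof -
    have "B = {v \<in> N y. \<delta> u v = q} - near"
      unfolding B_def far_eq by auto
    moreover have "near \<subseteq> {v \<in> N y. \<delta> u v = q}"
      using near_q unfolding near_def by blast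
    moreover have "card near \<le> card {v \<in> N y. \<delta> u v = q}"
      using calculation(2) by (intro card_mono) auto
    moreover have "finite near"
      by (simp add: near_def)
    ultimately have "card {v \<in> N y. \<delta> u v = q} = card B + card near"
      by (simp add: card_Diff_subset)
    then show ?thesis
      using near by linarith
  qed
  have "(\<Sum>v\<in>far_N y x. w u v)
    = (\<Sum>v\<in>far_N y x. (if \<delta> u v + 1 = q then real_of_int (c (q + 1) - a) / (c q * D) else 0)
        + (if \<delta> u v = q then 1 / D else 0))"
    by (intro sum.cong) (auto simp: w_def D_def)
  also have "\<dots> = real (card A) * ((c (q + 1) - a) / (c q * D)) + real (card B) / D"
    by (simp add: sum.distrib sum.If_cases Int_def A_def B_def)
  finally have sum_eq: "(\<Sum>v\<in>far_N y x. w u v)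
    = real (card A) * ((c (q + 1) - a) / (c q * D)) + real (card B) / D" .
  have "\<delta> u y \<le> q + 1"
    using dist_triangle[of u x y] u xy uN dist_sym[of u x] by (simp add: in_N_iff)
  then consider "\<delta> u y = q" | "\<delta> u y = q + 1"
    using q by linarith
  then have "(\<Sum>v\<in>far_N y x. w u v) = 1 \<and> (\<delta> u y = q \<longrightarrow> int (card A) = c q)"
  proof cases
    case 1
    have A: "int (card A) = c q"
      using card_N_closer[of u y] u xy 1 by (simp add: A_eq)
    moreover have "int (card B) = a - c q"
      using card_N_level[of u y] u xy 1 B_card regular a_eq by simp
    ultimately have AB: "real (card A) = c q" "real (card B) = a - c q"
      by (metis of_int_of_nat_eq)+
    have "(\<Sum>v\<in>far_N y x. w u v) = real_of_int (c (q + 1) - a) / D + real_of_int (a - c q) / D"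
      unfolding sum_eq AB using cq by simp
    also have "\<dots> = 1"
      using D by (simp add: D_def flip: add_divide_distrib)
    finally show ?thesis
      using A by simp
  next
    case 2
    \<comment> \<open>A neighbour of \<open>y\<close> at distance \<open>q - 1\<close> from
      \<open>u\<close> would put \<open>y\<close> within distance \<open>q\<close> of
      \<open>u\<close>.\<close>
    have "v \<notin> A" for v
      using dist_N[of y u v] 2 u xy by (auto simp: A_eq)
    then have "A = {}"
      by blast
    moreover have "int (card B) = D"
      using card_N_closer[of u y] u xy 2 B_card by (simp add: D_def)
    then have "real (card B) = D"
      by (metis of_int_of_nat_eq)
    ultimately show ?thesis
      using 2 D unfolding sum_eq by simp
  qed
  then show "(\<Sum>v\<in>far_N y x. w u v) = 1"
    and "\<delta> u y = q \<Longrightarrow> int (card {v \<in> far_N y x. \<delta> u v + 1 = q}) = c q"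
    by (auto simp: A_def)
qed

text \<open>Double counting: \<open>w\<close> has unit row and column sums, so the weighted sum of
  \<open>f u - g v\<close> over all pairs is the difference of the plain sums of \<open>f\<close>
  and \<open>g\<close>. It is bounded below pair by pair.\<close>

lemma b_c_drop:
  assumes verts: "x \<in> verts G" "y \<in> verts G" "z \<in> verts G"
    and xy: "\<delta> x y = q" and zy: "\<delta> z y = \<delta> z x + q"
  shows "2 * c q + real_of_int (a * (c (q + 1) - a)) / (c (q + 1) - c q)
    \<le> (b (\<delta> z x) - c (\<delta> z x)) - (b (\<delta> z x + q) - c (\<delta> z x + q))"
proof -
  define i where "i = \<delta> z x"
  define D where "D = c (q + 1) - c q"
  have D: "D > 0"
    using c_less by (simp add: D_def)
  have cq: "c q > 0"
    using c_pos verts xy q_pos by metis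
  define s where "s = real_of_int (c (q + 1) - a) / (c q * D)"
  \<comment> \<open>Here \<open>a_le\<close> enters: the weight of a pair at distance
    \<open>q - 1\<close> must not be negative.\<close>
  have s: "s \<ge> 0"
    using a_le cq D by (simp add: s_def)
  have yx: "\<delta> y x = q"
    using verts xy dist_sym by simp
  define f where "f u = int (\<delta> z u) - int i" for u
  define g where "g v = int (\<delta> z v) - int (i + q)" for v
  define X where "X = far_N x y"
  define Y where "Y = far_N y x"

  have near_sum: "(\<Sum>u\<in>N x. f u) = c q + (\<Sum>u\<in>X. f u)"
  proof -
    \<comment> \<open>As \<open>z\<close> is at distance \<open>i + q\<close> from \<open>y\<close>,
      such a \<open>u\<close> is at distance at least \<open>i + 1\<close> from
      \<open>z\<close>.\<close>
    have "f u = 1" if "u \<in> N x" "\<delta> y u + 1 = q" for u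
    proof -
      have "u \<in> verts G"
        using that by (simp add: in_N_iff)
      then show ?thesis
        using dist_triangle[of z u y] dist_sym[of y u] dist_N(1)[of x z u] verts zy that
        by (simp add: f_def i_def)
    qed
    then show ?thesis
      using sum_near_far[OF verts(1,2) yx, of f 1] by (simp add: X_def)
  qed
  have near_sum': "(\<Sum>v\<in>N y. g v) = - c q + (\<Sum>v\<in>Y. g v)"
  proof -
    have "g v = - 1" if "v \<in> N y" "\<delta> x v + 1 = q" for v
    proof -
      have "v \<in> verts G"
        using that by (simp add: in_N_iff)
      then show ?thesis
        using dist_triangle[of z x v] dist_N(2)[of y z v] verts zy that
        by (simp add: g_def i_def)
    qed
    then show ?thesis
      using sum_near_far[OF verts(2,1) xy, of g "- 1"] by (simp add: Y_def)
  qed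
  have rows: "(\<Sum>v\<in>Y. w u v) = 1" if "u \<in> X" for u
    using sum_w(1)[of x y u] verts xy that by (simp add: X_def Y_def)
  have w_sym: "w u v = w v u" if "u \<in> X" "v \<in> Y" for u v
    using that dist_sym[of u v] by (simp add: w_def X_def Y_def far_N_def in_N_iff)
  \<comment> \<open>By symmetry of \<open>w\<close>, a column sum is a row sum with \<open>x\<close>
    and \<open>y\<close> exchanged.\<close>
  have cols: "(\<Sum>u\<in>X. w u v) = 1" if "v \<in> Y" for v
  proof -
    have "(\<Sum>u\<in>X. w u v) = (\<Sum>u\<in>X. w v u)"
      using w_sym that by (intro sum.cong) auto
    then show ?thesis
      using sum_w(1)[of y x v] verts yx that by (simp add: X_def Y_def)
  qed

  have pair: "(if \<delta> u v + 1 = q then s else 0) \<le> w u v * (f u - g v)"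
    if "u \<in> X" "v \<in> Y" for u v
  proof -
    have uv: "u \<in> verts G" "v \<in> verts G"
      using that by (auto simp: X_def Y_def far_N_def in_N_iff)
    have tri: "g v - f u \<le> int (\<delta> u v) - int q"
      using dist_triangle[of z u v] verts uv by (simp add: f_def g_def)
    consider "\<delta> u v + 1 = q" | "\<delta> u v = q" | "\<delta> u v + 1 \<noteq> q" "\<delta> u v \<noteq> q"
      by blast
    then show ?thesis
    proof cases
      case 1
      then have "w u v = s"
        by (simp add: w_def s_def D_def)
      moreover have "1 \<le> f u - g v"
        using tri 1 by linarith
      then have "1 \<le> real_of_int (f u - g v)"
        by linarith
      ultimately show ?thesis
        using 1 s mult_left_mono[of 1 "real_of_int (f u - g v)" s] by simp
    next
      case 2
      then have "0 \<le> f u - g v"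
        using tri by linarith
      then have "0 \<le> real_of_int (f u - g v)"
        by linarith
      moreover have "0 \<le> w u v"
        using 2 c_less by (simp add: w_def)
      ultimately show ?thesis
        using 2 by auto
    next
      case 3
      then show ?thesis
        by (simp add: w_def)
    qed
  qed

  have level: "int (card {u \<in> X. \<delta> u y = q}) = a"
  proof -
    have "{u \<in> X. \<delta> u y = q} = {u \<in> N x. \<delta> y u = \<delta> y x}"
      using dist_sym[of y] verts yx by (auto simp: X_def far_N_def in_N_iff)
    then show ?thesis
      using card_N_level[of y x] verts yx regular a_eq by simp
  qed
  \<comment> \<open>The fraction arises here: each of the \<open>a\<close> vertices of
    \<open>X\<close> at distance \<open>q\<close> from \<open>y\<close> has \<open>c q\<close>
    partners at distance \<open>q - 1\<close>, each with surplus \<open>s\<close>.\<close>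
  have "a * (c q * s) = (\<Sum>u\<in>{u \<in> X. \<delta> u y = q}. c q * s)"
    using level by (metis sum_constant of_int_of_nat_eq)
  also have "\<dots> = (\<Sum>u\<in>{u \<in> X. \<delta> u y = q}. \<Sum>v\<in>Y. if \<delta> u v + 1 = q then s else 0)"
  proof (intro sum.cong refl)
    fix u
    assume "u \<in> {u \<in> X. \<delta> u y = q}"
    then have "int (card {v \<in> Y. \<delta> u v + 1 = q}) = c q"
      using sum_w(2)[of x y u] verts xy by (simp add: X_def Y_def)
    then have "real (card {v \<in> Y. \<delta> u v + 1 = q}) = c q"
      by (metis of_int_of_nat_eq)
    then show "c q * s = (\<Sum>v\<in>Y. if \<delta> u v + 1 = q then s else 0)"
      by (simp add: sum.If_cases Int_def Y_def)
  qed
  also have "\<dots> \<le> (\<Sum>u\<in>X. \<Sum>v\<in>Y. if \<delta> u v + 1 = q then s else 0)"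
    using s by (intro sum_mono2) (auto simp: X_def intro!: sum_nonneg)
  also have "\<dots> \<le> (\<Sum>u\<in>X. \<Sum>v\<in>Y. w u v * (f u - g v))"
    using pair by (intro sum_mono) auto
  also have "\<dots> = (\<Sum>u\<in>X. \<Sum>v\<in>Y. w u v * f u) - (\<Sum>u\<in>X. \<Sum>v\<in>Y. w u v * g v)"
    by (simp add: right_diff_distrib sum_subtractf)
  also have "(\<Sum>u\<in>X. \<Sum>v\<in>Y. w u v * f u) = (\<Sum>u\<in>X. f u)"
    using rows by (simp flip: sum_distrib_right)
  also have "(\<Sum>u\<in>X. \<Sum>v\<in>Y. w u v * g v) = (\<Sum>v\<in>Y. g v)"
    using cols by (subst sum.swap) (simp flip: sum_distrib_right)
  finally have "a * (c q * s) \<le> real_of_int ((\<Sum>u\<in>X. f u) - (\<Sum>v\<in>Y. g v))"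
    by simp
  also have "(\<Sum>u\<in>X. f u) - (\<Sum>v\<in>Y. g v) = (b i - c i) - (b (i + q) - c (i + q)) - 2 * c q"
  proof -
    have "(\<Sum>u\<in>N x. f u) = b i - c i" "(\<Sum>v\<in>N y. g v) = b (i + q) - c (i + q)"
      using sum_dist_N[of x z] sum_dist_N[of y z] verts zy by (simp_all add: f_def g_def i_def)
    then show ?thesis
      using near_sum near_sum' by simp
  qed
  also have "a * (c q * s) = real_of_int (a * (c (q + 1) - a)) / D"
    using cq D by (simp add: s_def field_simps)
  finally have bound: "real_of_int (a * (c (q + 1) - a)) / D
    \<le> real_of_int ((b i - c i) - (b (i + q) - c (i + q)) - 2 * c q)" .
  have "real_of_int m + t \<le> real_of_int n" if "t \<le> real_of_int (n - m)" for m n t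
    using that by simp
  from this[OF bound] show ?thesis
    unfolding i_def D_def .
qed

end

section \<open>Iterating the drop along a geodesic of length \<open>d\<close>\<close>

theorem theorem1p3:
  fixes G :: "('a, 'b) pre_digraph"
    and a b c :: "nat \<Rightarrow> int"
    and d k q p :: nat
    and M :: int
  assumes drg: "distance_regular_graph G b c"
    and diam: "graph_diameter G = d"
    and valency: "\<And>x. x \<in> verts G \<Longrightarrow> out_degree G x = k"
    and a_def: "\<And>i. i \<le> d \<Longrightarrow> a i = int k - b i - c i"
    and q_range: "1 \<le> q" "q \<le> d - 1"
    and a_zero: "a (q - 1) = 0"
    and c_step: "c (q + 1) > c q"
    and c_ge: "c (q + 1) \<ge> a q"
    and p_range: "p \<le> d"
    and M_def: "M = \<lceil>real_of_int (a q * (c (q + 1) - a q)) / real_of_int (c (q + 1) - c q)\<rceil>"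
  shows "int d \<le> (MAX r\<in>{0..q - 1}.
    \<lfloor>real_of_int (b p - c p + b r - c r) / real_of_int (2 * c q + M)\<rfloor> * int q + int p + int r)"
proof -
  interpret distance_regular_graph G b c
    by (rule drg)
  interpret drg_step G b c k q "a q"
    using valency a_def[of q] a_def[of "q - 1"] q_range a_zero c_step c_ge
    by unfold_locales auto
  have "verts G \<noteq> {}"
    using conn by (auto simp: connected_def strongly_connected_def)
  moreover have "{\<delta> x y | x y. x \<in> verts G \<and> y \<in> verts G} = (\<lambda>(x, y). \<delta> x y) ` (verts G \<times> verts G)"
    by auto
  ultimately have "d \<in> {\<delta> x y | x y. x \<in> verts G \<and> y \<in> verts G}"
    unfolding diam[symmetric] graph_diameter_def by (intro Max_in) auto
  then obtain z y where zy: "z \<in> verts G" "y \<in> verts G" "\<delta> z y = d"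
    by auto
  \<comment> \<open>All configurations are cut from geodesics that start at one end \<open>z\<close>
    of a diametral pair.\<close>
  have geodesic: "\<exists>x x'. x \<in> verts G \<and> x' \<in> verts G \<and> \<delta> z x = i \<and> \<delta> x x' = j
      \<and> \<delta> z x' = i + j" if "i + j \<le> d" for i j
  proof -
    obtain x' where x': "x' \<in> verts G" "\<delta> z x' = i + j"
      using ex_between[of z y "i + j"] zy \<open>i + j \<le> d\<close> by auto
    obtain x where "x \<in> verts G" "\<delta> z x = i" "\<delta> x x' = \<delta> z x' - i"
      using ex_between[of z x' i] zy x' by auto
    then show ?thesis
      using x' by auto
  qed
  have q_le: "q \<le> d"
    using q_range by linarith
  obtain x x' where x: "x \<in> verts G" "x' \<in> verts G" "\<delta> x x' = q"
    using geodesic[of 0 q] q_le by auto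
  then have cq: "c q > 0"
    using c_pos[of x x'] q_range by simp
  have aq: "a q \<ge> 0"
    using card_N_level[of x x'] x valency a_def[of q] q_le by simp
  have "0 \<le> real_of_int (a q * (c (q + 1) - a q)) / real_of_int (c (q + 1) - c q)"
    using aq c_ge c_step by simp
  then have "M \<ge> 0"
    unfolding M_def by linarith
  then have pos: "2 * c q + M > 0"
    using cq by linarith
  have step: "2 * c q + M \<le> (b i - c i) - (b (i + q) - c (i + q))" if "i + q \<le> d" for i
  proof -
    obtain x x' where "x \<in> verts G" "x' \<in> verts G" "\<delta> z x = i" "\<delta> x x' = q" "\<delta> z x' = i + q"
      using geodesic[OF \<open>i + q \<le> d\<close>] by blast
    then have "real_of_int (a q * (c (q + 1) - a q)) / real_of_int (c (q + 1) - c q)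
      \<le> real_of_int ((b i - c i) - (b (i + q) - c (i + q)) - 2 * c q)"
      using b_c_drop[of x x' z] zy by simp
    \<comment> \<open>The right-hand side is an integer, so the fraction may be rounded up to
      \<open>M\<close>.\<close>
    then show ?thesis
      unfolding M_def ceiling_le_iff[symmetric] by linarith
  qed
  have steps: "int m * (2 * c q + M) \<le> (b p - c p) - (b (p + m * q) - c (p + m * q))"
    if "p + m * q \<le> d" for m
    using that
  proof (induction m)
    case (Suc m)
    then show ?case
      using step[of "p + m * q"] by (simp add: algebra_simps)
  qed simp
  define m r where "m = (d - p) div q" and "r = (d - p) mod q"
  have d: "d = (p + m * q) + r"
    using p_range by (simp add: m_def r_def)
  have r: "r \<in> {0..q - 1}"
    using q_range by (simp add: r_def less_Suc_eq_le[symmetric])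
  \<comment> \<open>Apply \<open>c_diff_b_le\<close> at the vertex at distance \<open>d - r\<close>
    from \<open>z\<close> on a geodesic of length \<open>d\<close>.\<close>
  have "c (p + m * q) - b (p + m * q) \<le> b r - c r"
  proof -
    obtain x x' where "x \<in> verts G" "x' \<in> verts G" "\<delta> z x = p + m * q" "\<delta> x x' = r"
      "\<delta> z x' = p + m * q + r"
      using geodesic[of "p + m * q" r] d by auto
    then show ?thesis
      using c_diff_b_le[of z x x'] zy by simp
  qed
  then have "int m * (2 * c q + M) \<le> b p - c p + b r - c r"
    using steps[of m] d by linarith
  then have "real_of_int (int m) * real_of_int (2 * c q + M) \<le> real_of_int (b p - c p + b r - c r)"
    by (metis of_int_le_iff of_int_mult)
  then have "int m \<le> \<lfloor>real_of_int (b p - c p + b r - c r) / real_of_int (2 * c q + M)\<rfloor>"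
    using pos by (simp add: le_floor_iff pos_le_divide_eq del: of_int_add of_int_diff of_int_mult)
  then have "int m * int q
    \<le> \<lfloor>real_of_int (b p - c p + b r - c r) / real_of_int (2 * c q + M)\<rfloor> * int q"
    by (intro mult_right_mono) auto
  then have "int d \<le> \<lfloor>real_of_int (b p - c p + b r - c r) / real_of_int (2 * c q + M)\<rfloor> * int q
    + int p + int r"
    by (subst d) simp
  also have "\<dots> \<le> (MAX r\<in>{0..q - 1}.
    \<lfloor>real_of_int (b p - c p + b r - c r) / real_of_int (2 * c q + M)\<rfloor> * int q + int p + int r)"
    using r by (intro Max_ge) auto
  finally show ?thesis .
qed

end
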